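(* Let $n\ge 3$, let $a_0,\ldots,a_{n-1}$ be indeterminates over $\mathbb{Q}$, $f=x^n+a_{n-1}x^{n-1}+\cdots+a_0$, and let $D_2\in\mathbb{Q}[a_0,\ldots,a_{n-1}]$ be the polynomial obtained by expressing $\prod_{1\le i,j,k\le n,\ i<j,\ j\ne k,\ k\ne i}(2r_k-r_i-r_j)$ ($r_1,\ldots,r_n$ the roots of $f$) in terms of $a_0,\ldots,a_{n-1}$ via Vieta's formulas. Then, in $\mathbb{Q}[a_0,\ldots,a_{n-1},x,y,w]$, \[D_2\in\left\langle f(x),f(y),f\left(\tfrac{x+y}{2}\right),w(x-y)-1\right\rangle\cap\mathbb{Q}[a_0,\ldots,a_{n-1}].\]
   Context: $\langle g_1,\ldots,g_m\rangle$ is the ideal generated by $g_1,\ldots,g_m$. *)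

theory Defs
  imports "HOL-Library.Poly_Mapping" "HOL-Computational_Algebra.Polynomial"
begin

text \<open>Multivariate polynomials over \<open>\<rat>\<close> in countably many indeterminates
  \<open>X_0, X_1, \<dots>\<close>: finitely supported maps from monomials (exponent vectors
  \<open>nat \<Rightarrow>\<^sub>0 nat\<close>) to coefficients. Multiplication is convolution, making
  this a commutative ring with 1.\<close>

type_synonym mpoly = "(nat \<Rightarrow>\<^sub>0 nat) \<Rightarrow>\<^sub>0 rat"

definition mvar :: "nat \<Rightarrow> mpoly" where
  "mvar i = Poly_Mapping.single (Poly_Mapping.single i 1) 1"

definition mconst :: "rat \<Rightarrow> mpoly" where
  "mconst c = Poly_Mapping.single 0 c"

definition mvars :: "mpoly \<Rightarrow> nat set" where
  "mvars p = (\<Union>m \<in> Poly_Mapping.keys p. Poly_Mapping.keys (m :: nat \<Rightarrow>\<^sub>0 nat))"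

definition msubst :: "(nat \<Rightarrow> mpoly) \<Rightarrow> mpoly \<Rightarrow> mpoly" where
  "msubst \<sigma> p = (\<Sum>m \<in> Poly_Mapping.keys p. mconst (Poly_Mapping.lookup p m) *
     (\<Prod>i \<in> Poly_Mapping.keys (m :: nat \<Rightarrow>\<^sub>0 nat). \<sigma> i ^ Poly_Mapping.lookup m i))"

definition ideal_gen :: "'a::comm_ring_1 list \<Rightarrow> 'a set" where
  "ideal_gen gs = {\<Sum>i<length gs. h i * gs ! i | h. True}"

text \<open>Conventions: in \<open>\<rat>[a_0,\<dots>,a_{n-1},x,y,w]\<close> the indeterminate \<open>a_i\<close>
  is \<open>X_i\<close> (\<open>i < n\<close>), \<open>x = X_n\<close>, \<open>y = X_{n+1}\<close>, \<open>w = X_{n+2}\<close>.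
  In the root ring \<open>\<rat>[r_1,\<dots>,r_n]\<close> the root \<open>r_{i+1}\<close> is \<open>X_i\<close> (\<open>i < n\<close>).\<close>

definition f_at :: "nat \<Rightarrow> mpoly \<Rightarrow> mpoly" where
  "f_at n t = t ^ n + (\<Sum>i<n. mvar i * t ^ i)"

definition vieta :: "nat \<Rightarrow> nat \<Rightarrow> mpoly" where
  "vieta n i = (if i < n then coeff (\<Prod>j<n. [:- mvar j, 1:]) i else 0)"

definition D2_roots :: "nat \<Rightarrow> mpoly" where
  "D2_roots n = (\<Prod>(i,j,k) \<in> {(i,j,k). i < n \<and> j < n \<and> k < n \<and> i < j \<and> j \<noteq> k \<and> k \<noteq> i}.
                   2 * mvar k - mvar i - mvar j)"

definition D2 :: "nat \<Rightarrow> mpoly" where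
  "D2 n = (THE D. mvars D \<subseteq> {..<n} \<and> msubst (vieta n) D = D2_roots n)"

end

theory Submission
  imports Defs "HOL-Computational_Algebra.Fundamental_Theorem_Algebra"
begin

text \<open>
  Write \<open>I\<close> for the ideal and \<open>z = (x + y) / 2\<close>. Modulo \<open>I\<close>, repeated division gives
  \<open>f \<equiv> (t - x) (t - y) (t - z) h\<close> with \<open>h\<close> monic, because \<open>x - y\<close> is a unit and \<open>x\<close>, \<open>y\<close>, \<open>z\<close> are
  roots of \<open>f\<close>. Hence \<open>D\<^sub>2\<close> is congruent to its value at the coefficients of that product. This
  value is the zero polynomial: at each complex point \<open>h\<close> splits into linear factors, and one
  factor of the product of all \<open>2 r\<^sub>k - r\<^sub>i - r\<^sub>j\<close> is \<open>2 z - x - y = 0\<close>.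

  That \<open>D\<^sub>2\<close> is well defined is the theorem on symmetric polynomials. Existence follows by
  averaging and reduction to power sums, uniqueness from the fact that every monic complex
  polynomial has roots.
\<close>

section \<open>Evaluation homomorphisms of multivariate polynomials\<close>

text \<open>The coefficient map \<open>\<phi>\<close> is a parameter so that a single theory covers
  substitution of polynomials (\<open>mconst\<close>) and evaluation at complex points
  (\<open>of_rat\<close>).\<close>

definition meval :: "(rat \<Rightarrow> 'b::comm_ring_1) \<Rightarrow> (nat \<Rightarrow> 'b) \<Rightarrow> mpoly \<Rightarrow> 'b" where
  "meval \<phi> \<sigma> p = (\<Sum>m \<in> Poly_Mapping.keys p. \<phi> (Poly_Mapping.lookup p m) *
     (\<Prod>i \<in> Poly_Mapping.keys m. \<sigma> i ^ Poly_Mapping.lookup m i))"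

lemma msubst_eq_meval: "msubst = meval mconst"
  by (intro ext) (simp add: msubst_def meval_def)

lemma poly_mapping_sum_single:
  fixes p :: "'a \<Rightarrow>\<^sub>0 'b::comm_monoid_add"
  shows "p = (\<Sum>m\<in>Poly_Mapping.keys p. Poly_Mapping.single m (Poly_Mapping.lookup p m))"
  by (rule poly_mapping_eqI)
     (auto simp: lookup_sum lookup_single when_def in_keys_iff sum.delta)

text \<open>All three products can be taken over the union of the two supports, since the added
  factors are zeroth powers; there the exponents simply add.\<close>

lemma monom_add:
  fixes \<sigma> :: "nat \<Rightarrow> 'b::comm_ring_1" and m m' :: "nat \<Rightarrow>\<^sub>0 nat"
  shows "(\<Prod>i\<in>Poly_Mapping.keys (m + m'). \<sigma> i ^ Poly_Mapping.lookup (m + m') i) =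
    (\<Prod>i\<in>Poly_Mapping.keys m. \<sigma> i ^ Poly_Mapping.lookup m i) *
    (\<Prod>i\<in>Poly_Mapping.keys m'. \<sigma> i ^ Poly_Mapping.lookup m' i)"
proof -
  have ext: "(\<Prod>i\<in>Poly_Mapping.keys k. \<sigma> i ^ Poly_Mapping.lookup k i) =
      (\<Prod>i\<in>Poly_Mapping.keys m \<union> Poly_Mapping.keys m'. \<sigma> i ^ Poly_Mapping.lookup k i)"
    if "Poly_Mapping.keys k \<subseteq> Poly_Mapping.keys m \<union> Poly_Mapping.keys m'" for k :: "nat \<Rightarrow>\<^sub>0 nat"
    using that by (intro prod.mono_neutral_left) (auto simp: in_keys_iff)
  show ?thesis
    using ext[of m] ext[of m'] ext[of "m + m'"] keys_add[of m m']
    by (simp add: lookup_add power_add prod.distrib)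
qed

locale rat_hom =
  fixes \<phi> :: "rat \<Rightarrow> 'b::comm_ring_1"
  assumes hom_0: "\<phi> 0 = 0" and hom_1: "\<phi> 1 = 1"
    and hom_add: "\<phi> (a + b) = \<phi> a + \<phi> b" and hom_mult: "\<phi> (a * b) = \<phi> a * \<phi> b"
begin

lemma meval_0 [simp]: "meval \<phi> \<sigma> 0 = 0"
  by (simp add: meval_def)

lemma meval_add: "meval \<phi> \<sigma> (p + q) = meval \<phi> \<sigma> p + meval \<phi> \<sigma> q"
  unfolding meval_def by (rule setsum_keys_plus_distrib) (simp_all add: hom_0 hom_add algebra_simps)

lemma meval_uminus: "meval \<phi> \<sigma> (- p) = - meval \<phi> \<sigma> p"
  using meval_add[of \<sigma> p "- p"] by (simp add: add_eq_0_iff)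

lemma meval_diff: "meval \<phi> \<sigma> (p - q) = meval \<phi> \<sigma> p - meval \<phi> \<sigma> q"
  using meval_add[of \<sigma> p "- q"] by (simp add: meval_uminus)

lemma meval_sum: "meval \<phi> \<sigma> (\<Sum>i\<in>A. g i) = (\<Sum>i\<in>A. meval \<phi> \<sigma> (g i))"
  by (induction A rule: infinite_finite_induct) (simp_all add: meval_add)

lemma meval_single: "meval \<phi> \<sigma> (Poly_Mapping.single m c) =
    \<phi> c * (\<Prod>i\<in>Poly_Mapping.keys m. \<sigma> i ^ Poly_Mapping.lookup m i)"
  by (simp add: meval_def hom_0)

lemma meval_mconst [simp]: "meval \<phi> \<sigma> (mconst c) = \<phi> c"
  by (simp add: mconst_def meval_single)

lemma meval_mvar [simp]: "meval \<phi> \<sigma> (mvar i) = \<sigma> i"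
  by (simp add: mvar_def meval_single hom_1)

lemma meval_1 [simp]: "meval \<phi> \<sigma> 1 = 1"
  using meval_mconst[of \<sigma> 1] by (simp add: mconst_def hom_1)

lemma meval_mult: "meval \<phi> \<sigma> (p * q) = meval \<phi> \<sigma> p * meval \<phi> \<sigma> q"
proof -
  have single: "meval \<phi> \<sigma> (Poly_Mapping.single m c * Poly_Mapping.single m' c') =
      meval \<phi> \<sigma> (Poly_Mapping.single m c) * meval \<phi> \<sigma> (Poly_Mapping.single m' c')" for m m' c c'
    by (simp add: mult_single meval_single monom_add hom_mult mult_ac)
  \<comment> \<open>By bilinearity the monomial case suffices. The index sets and coefficients are
    kept arbitrary because rewriting \<open>p\<close> as a sum over its own keys would loop.\<close>
  have "meval \<phi> \<sigma> ((\<Sum>m\<in>A. Poly_Mapping.single m (a m)) * (\<Sum>m\<in>B. Poly_Mapping.single m (b m))) =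
      meval \<phi> \<sigma> (\<Sum>m\<in>A. Poly_Mapping.single m (a m)) * meval \<phi> \<sigma> (\<Sum>m\<in>B. Poly_Mapping.single m (b m))"
    for A B a b
    by (simp add: sum_product meval_sum single)
  from this[of "Poly_Mapping.lookup p" "Poly_Mapping.keys p" "Poly_Mapping.lookup q" "Poly_Mapping.keys q"]
  show ?thesis
    by (simp only: poly_mapping_sum_single[symmetric])
qed

lemma meval_power: "meval \<phi> \<sigma> (p ^ k) = meval \<phi> \<sigma> p ^ k"
  by (induction k) (simp_all add: meval_mult)

lemma meval_prod: "meval \<phi> \<sigma> (\<Prod>i\<in>A. g i) = (\<Prod>i\<in>A. meval \<phi> \<sigma> (g i))"
  by (induction A rule: infinite_finite_induct) (simp_all add: meval_mult)

lemma meval_numeral [simp]: "meval \<phi> \<sigma> (numeral k) = numeral k"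
proof -
  have "meval \<phi> \<sigma> (of_nat j) = of_nat j" for j
    by (induction j) (simp_all add: meval_add)
  from this[of "numeral k"] show ?thesis by simp
qed

lemma meval_msubst: "meval \<phi> \<sigma> (msubst \<tau> p) = meval \<phi> (\<lambda>i. meval \<phi> \<sigma> (\<tau> i)) p"
  by (simp add: msubst_def meval_sum meval_mult meval_prod meval_power meval_def[of \<phi> _ p])

lemma coeff_map_poly_meval: "coeff (map_poly (meval \<phi> \<sigma>) P) i = meval \<phi> \<sigma> (coeff P i)"
  by (simp add: coeff_map_poly)

lemma map_poly_meval_mult:
  "map_poly (meval \<phi> \<sigma>) (P * Q) = map_poly (meval \<phi> \<sigma>) P * map_poly (meval \<phi> \<sigma>) Q"
  by (intro poly_eqI) (simp add: coeff_map_poly coeff_mult meval_sum meval_mult)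

lemma map_poly_meval_linear: "map_poly (meval \<phi> \<sigma>) [:- c, 1:] = [:- meval \<phi> \<sigma> c, 1:]"
  by (simp add: map_poly_pCons meval_uminus)

lemma map_poly_meval_prod:
  "map_poly (meval \<phi> \<sigma>) (\<Prod>i\<in>A. g i) = (\<Prod>i\<in>A. map_poly (meval \<phi> \<sigma>) (g i))"
  by (induction A rule: infinite_finite_induct) (simp_all add: map_poly_meval_mult)

end

lemma meval_cong: "(\<And>i. i \<in> mvars p \<Longrightarrow> \<sigma> i = \<tau> i) \<Longrightarrow> meval \<phi> \<sigma> p = meval \<phi> \<tau> p"
  unfolding meval_def mvars_def by (intro sum.cong refl arg_cong2[where f = "(*)"] prod.cong) (auto intro!: arg_cong2[where f = "(^)"])

interpretation mconst: rat_hom mconst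
  by standard (simp_all add: mconst_def single_add mult_single)

interpretation of_rat: rat_hom "of_rat :: rat \<Rightarrow> complex"
  by standard (simp_all add: of_rat_add of_rat_mult)

text \<open>Lets \<open>D2 n\<close> be read as its own value at the indeterminates, that is, at the
  coefficients of the generic polynomial.\<close>

lemma msubst_mvar: "msubst mvar p = p"
proof -
  have mono: "(\<Prod>i\<in>Poly_Mapping.keys m. mvar i ^ Poly_Mapping.lookup m i) = Poly_Mapping.single m 1"
    for m :: "nat \<Rightarrow>\<^sub>0 nat"
  proof -
    have pow: "mvar i ^ k = Poly_Mapping.single (Poly_Mapping.single i k) 1" for i k
      by (induction k) (simp_all add: mvar_def mult_single flip: single_add)
    have "(\<Prod>i\<in>A. Poly_Mapping.single (g i) (1::rat)) = Poly_Mapping.single (\<Sum>i\<in>A. g i) 1"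
      for A :: "nat set" and g :: "nat \<Rightarrow> nat \<Rightarrow>\<^sub>0 nat"
      by (induction A rule: infinite_finite_induct) (simp_all add: mult_single)
    thus ?thesis
      by (simp only: pow poly_mapping_sum_single[symmetric])
  qed
  show ?thesis
    unfolding msubst_def mono mconst_def mult_single
    by (simp only: add_0 mult_1_right poly_mapping_sum_single[symmetric])
qed

section \<open>Variables occurring in a polynomial\<close>

lemma mvars_mconst [simp]: "mvars (mconst c) = {}"
  by (simp add: mvars_def mconst_def)

lemma mvars_1 [simp]: "mvars 1 = {}"
  by (simp add: mvars_def)

lemma mvars_numeral [simp]: "mvars (numeral k) = {}"
  using mvars_mconst[of "numeral k"] by (simp add: mconst_def)

lemma mvars_mvar [simp]: "mvars (mvar i) = {i}"
  by (simp add: mvars_def mvar_def)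

lemma mvars_add: "mvars (p + q) \<subseteq> mvars p \<union> mvars q"
  using keys_add[of p q] by (auto simp: mvars_def)

lemma mvars_uminus [simp]: "mvars (- p) = mvars p"
  by (simp add: mvars_def in_keys_iff)

lemma mvars_diff: "mvars (p - q) \<subseteq> mvars p \<union> mvars q"
  using mvars_add[of p "- q"] by simp

lemma mvars_mult: "mvars (p * q) \<subseteq> mvars p \<union> mvars q"
proof
  fix i assume "i \<in> mvars (p * q)"
  then obtain m where "m \<in> Poly_Mapping.keys (p * q)" "i \<in> Poly_Mapping.keys m"
    by (auto simp: mvars_def)
  moreover from this obtain a b where "m = a + b" "a \<in> Poly_Mapping.keys p" "b \<in> Poly_Mapping.keys q"
    using keys_mult by blast
  ultimately show "i \<in> mvars p \<union> mvars q"
    using keys_add[of a b] by (auto simp: mvars_def)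
qed

lemma mvars_prod: "(\<And>i. i \<in> A \<Longrightarrow> mvars (g i) \<subseteq> V) \<Longrightarrow> mvars (\<Prod>i\<in>A. g i) \<subseteq> V"
proof (induction A rule: infinite_finite_induct)
  case (insert x F)
  thus ?case using mvars_mult[of "g x" "prod g F"] by auto
qed auto

section \<open>Polynomials are determined by their complex values\<close>

text \<open>Dedekind's argument: distinct monomials are distinct characters of the multiplicative
  monoid of all points, hence linearly independent.\<close>

lemma monomials_linearly_independent:
  fixes a :: "(nat \<Rightarrow>\<^sub>0 nat) \<Rightarrow> complex"
  assumes "finite K"
    and "\<And>c. (\<Sum>m\<in>K. a m * (\<Prod>i\<in>Poly_Mapping.keys m. c i ^ Poly_Mapping.lookup m i)) = 0"
    and "m \<in> K"
  shows "a m = 0"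
  using assms
proof (induction K arbitrary: a m rule: finite_induct)
  case (insert m0 K)
  define \<chi> :: "(nat \<Rightarrow>\<^sub>0 nat) \<Rightarrow> (nat \<Rightarrow> complex) \<Rightarrow> complex"
    where "\<chi> m c = (\<Prod>i\<in>Poly_Mapping.keys m. c i ^ Poly_Mapping.lookup m i)" for m c
  have \<chi>_mult: "\<chi> m (\<lambda>i. c i * d i) = \<chi> m c * \<chi> m d" for m c d
    by (simp add: \<chi>_def power_mult_distrib prod.distrib)
  have zero: "a m0 * \<chi> m0 c + (\<Sum>m\<in>K. a m * \<chi> m c) = 0" for c
    using insert.prems(1)[of c] insert.hyps by (simp add: \<chi>_def)
  have K: "a k = 0" if "k \<in> K" for k
  proof -
    have "k \<noteq> m0" using that insert.hyps by auto
    then obtain j where j: "Poly_Mapping.lookup k j \<noteq> Poly_Mapping.lookup m0 j"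
      by (meson poly_mapping_eqI)
    \<comment> \<open>At this point a monomial takes the value 2 to the power of its exponent at
      \<open>j\<close>, which separates \<open>k\<close> from \<open>m0\<close>.\<close>
    define d :: "nat \<Rightarrow> complex" where "d = (\<lambda>i. if i = j then 2 else 1)"
    have \<chi>_d: "\<chi> m d = 2 ^ Poly_Mapping.lookup m j" for m
    proof -
      have "\<chi> m d = (\<Prod>i\<in>Poly_Mapping.keys m. if i = j then 2 ^ Poly_Mapping.lookup m i else 1)"
        unfolding \<chi>_def d_def by (intro prod.cong) auto
      thus ?thesis by (simp add: prod.delta in_keys_iff)
    qed
    have "a k * (\<chi> k d - \<chi> m0 d) = 0"
    proof (rule insert.IH[OF _ that])
      fix c
      \<comment> \<open>The relation at the product point \<open>c * d\<close> minus
        \<open>\<chi> m0 d\<close> times the relation at \<open>c\<close>: the term of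
        \<open>m0\<close> cancels and a relation over \<open>K\<close> alone remains.\<close>
      have "(\<Sum>m\<in>K. a m * (\<chi> m d - \<chi> m0 d) * \<chi> m c) =
          (a m0 * \<chi> m0 (\<lambda>i. c i * d i) + (\<Sum>m\<in>K. a m * \<chi> m (\<lambda>i. c i * d i)))
          - \<chi> m0 d * (a m0 * \<chi> m0 c + (\<Sum>m\<in>K. a m * \<chi> m c))"
        by (simp add: \<chi>_mult algebra_simps sum_distrib_left sum_subtractf)
      also have "\<dots> = 0" unfolding zero by simp
      finally show "(\<Sum>m\<in>K. a m * (\<chi> m d - \<chi> m0 d) *
          (\<Prod>i\<in>Poly_Mapping.keys m. c i ^ Poly_Mapping.lookup m i)) = 0"
        by (simp add: \<chi>_def)
    qed
    moreover have "\<chi> k d \<noteq> \<chi> m0 d"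
      using j power_inject_exp[of "2::real"] unfolding \<chi>_d
      by (metis norm_numeral norm_power one_less_numeral_iff semiring_norm(76))
    ultimately show ?thesis by simp
  qed
  have "a m0 = 0"
    using zero[of "\<lambda>_. 1"] K by (simp add: \<chi>_def)
  with K insert.prems(2) show ?case by auto
qed auto

text \<open>Reduces polynomial identities to complex points, where monic polynomials split.\<close>

lemma mpoly_eq_0_if_vanishing:
  assumes "\<And>c. meval (of_rat :: rat \<Rightarrow> complex) c p = 0"
  shows "p = 0"
proof -
  have "of_rat (Poly_Mapping.lookup p m) = (0::complex)" if "m \<in> Poly_Mapping.keys p" for m
    using assms that
    by (intro monomials_linearly_independent[of "Poly_Mapping.keys p" "\<lambda>m. of_rat (Poly_Mapping.lookup p m)"])
       (simp_all add: meval_def)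
  thus ?thesis
    by (intro poly_mapping_eqI) (auto simp: in_keys_iff)
qed

section \<open>The ring generated by the elementary symmetric polynomials\<close>

definition root_poly :: "nat \<Rightarrow> mpoly poly" where
  "root_poly n = (\<Prod>j<n. [:- mvar j, 1:])"

text \<open>Up to sign, \<open>vieta n\<close> lists the elementary symmetric polynomials, so this
  is the subring they generate over the rationals. Membership of \<open>D2_roots n\<close> is the
  existence half of the definition of \<open>D2\<close>.\<close>

definition elementary_ring :: "nat \<Rightarrow> mpoly set" where
  "elementary_ring n = {msubst (vieta n) D | D. mvars D \<subseteq> {..<n}}"

lemma degree_prod_linear:
  fixes r :: "nat \<Rightarrow> 'a::idom"
  shows "degree (\<Prod>j<n. [:- r j, 1:]) = n" and "coeff (\<Prod>j<n. [:- r j, 1:]) n = 1"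
proof -
  show deg: "degree (\<Prod>j<n. [:- r j, 1:]) = n"
    by (subst degree_prod_eq_sum_degree) auto
  have "lead_coeff (\<Prod>j<n. [:- r j, 1:]) = 1"
    by (simp add: lead_coeff_prod)
  thus "coeff (\<Prod>j<n. [:- r j, 1:]) n = 1" by (simp add: deg)
qed

text \<open>Unfolds the Horner recurrence \<open>q_j = P_(j+1) + c * q_(j+1)\<close> downwards from
  \<open>j = d\<close>. Summed over all roots \<open>c\<close>, the powers of \<open>c\<close>
  become power sums.\<close>

lemma coeff_synthetic_div:
  fixes P :: "'a::comm_ring_1 poly"
  assumes "degree P \<le> d"
  shows "coeff (synthetic_div P c) j = (\<Sum>i<d - j. coeff P (Suc (j + i)) * c ^ i)"
proof (induction "d - j" arbitrary: j)
  case 0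
  hence "coeff (synthetic_div P c) j = 0"
  \<comment> \<open>The quotient has degree \<open>degree P - 1\<close> in truncated subtraction, so
    a constant \<open>P\<close> needs its own argument when \<open>j = 0\<close>.\<close>
  proof (cases "degree P = 0")
    case True
    thus ?thesis by (simp add: synthetic_div_eq_0_iff[THEN iffD2])
  next
    case False
    thus ?thesis using 0 assms by (intro coeff_eq_0) (simp add: degree_synthetic_div)
  qed
  thus ?case using 0 by simp
next
  case (Suc k)
  have "coeff (synthetic_div P c) j = coeff P (Suc j) + c * coeff (synthetic_div P c) (Suc j)"
    using arg_cong[OF synthetic_div_correct[of P c], of "\<lambda>q. coeff q (Suc j)"] by simp
  also have "coeff (synthetic_div P c) (Suc j) = (\<Sum>i<k. coeff P (Suc (Suc j + i)) * c ^ i)"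
  proof -
    have "k = d - Suc j" using Suc.hyps(2) by simp
    from Suc.hyps(1)[OF this] this show ?thesis by simp
  qed
  also have "coeff P (Suc j) + c * \<dots> = (\<Sum>i<Suc k. coeff P (Suc (j + i)) * c ^ i)"
    by (subst sum.lessThan_Suc_shift) (simp add: sum_distrib_left mult_ac)
  finally show ?case using Suc.hyps(2) by simp
qed

context
  fixes n :: nat
begin

lemma elementary_ring_mconst: "mconst c \<in> elementary_ring n"
  unfolding elementary_ring_def
  by (auto simp: msubst_eq_meval intro!: exI[of _ "mconst c"])

lemma elementary_ring_add:
  assumes "p \<in> elementary_ring n" "q \<in> elementary_ring n"
  shows "p + q \<in> elementary_ring n"
proof -
  obtain D D' where "p = msubst (vieta n) D" "q = msubst (vieta n) D'"
      "mvars D \<subseteq> {..<n}" "mvars D' \<subseteq> {..<n}"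
    using assms unfolding elementary_ring_def by blast
  thus ?thesis
    using mvars_add[of D D'] unfolding elementary_ring_def
    by (auto simp: msubst_eq_meval mconst.meval_add intro!: exI[of _ "D + D'"])
qed

lemma elementary_ring_mult:
  assumes "p \<in> elementary_ring n" "q \<in> elementary_ring n"
  shows "p * q \<in> elementary_ring n"
proof -
  obtain D D' where "p = msubst (vieta n) D" "q = msubst (vieta n) D'"
      "mvars D \<subseteq> {..<n}" "mvars D' \<subseteq> {..<n}"
    using assms unfolding elementary_ring_def by blast
  thus ?thesis
    using mvars_mult[of D D'] unfolding elementary_ring_def
    by (auto simp: msubst_eq_meval mconst.meval_mult intro!: exI[of _ "D * D'"])
qed

lemma elementary_ring_0: "0 \<in> elementary_ring n"
  using elementary_ring_mconst[of 0] by (simp add: mconst_def)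

lemma elementary_ring_1: "1 \<in> elementary_ring n"
  using elementary_ring_mconst[of 1] by (simp add: mconst_def)

lemma elementary_ring_of_nat: "of_nat k \<in> elementary_ring n"
  using elementary_ring_mconst[of "of_nat k"] by (simp add: mconst_def)

lemma elementary_ring_uminus: "p \<in> elementary_ring n \<Longrightarrow> - p \<in> elementary_ring n"
  using elementary_ring_mult[OF elementary_ring_mconst[of "-1"]]
  by (simp add: mconst_def single_uminus)

lemma elementary_ring_diff:
  "p \<in> elementary_ring n \<Longrightarrow> q \<in> elementary_ring n \<Longrightarrow> p - q \<in> elementary_ring n"
  using elementary_ring_add[OF _ elementary_ring_uminus] by fastforce

lemma elementary_ring_sum:
  "(\<And>i. i \<in> A \<Longrightarrow> g i \<in> elementary_ring n) \<Longrightarrow> (\<Sum>i\<in>A. g i) \<in> elementary_ring n"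
  by (induction A rule: infinite_finite_induct) (auto intro: elementary_ring_add elementary_ring_0)

lemma degree_root_poly: "degree (root_poly n) = n"
  and lead_coeff_root_poly: "coeff (root_poly n) n = 1"
  using degree_prod_linear[of mvar n] by (simp_all add: root_poly_def)

lemma coeff_root_poly_in_elementary_ring: "coeff (root_poly n) i \<in> elementary_ring n"
proof -
  consider "i < n" | "i = n" | "i > n" by linarith
  thus ?thesis
  proof cases
    case 1
    thus ?thesis
      unfolding elementary_ring_def
      by (auto simp: msubst_eq_meval vieta_def root_poly_def intro!: exI[of _ "mvar i"])
  next
    case 2
    thus ?thesis by (simp add: lead_coeff_root_poly elementary_ring_1)
  next
    case 3
    thus ?thesis by (simp add: coeff_eq_0 degree_root_poly elementary_ring_0)
  qed
qed

section \<open>Newton's identities and power sums\<close>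

text \<open>Newton's identities, read off from \<open>F' = \<Sum>\<^sub>l F / (t - r\<^sub>l)\<close> for \<open>F = \<Prod>\<^sub>l (t - r\<^sub>l)\<close>.\<close>

lemma newton_identity:
  "of_nat (Suc j) * coeff (root_poly n) (Suc j) =
    (\<Sum>i<n - j. coeff (root_poly n) (Suc (j + i)) * (\<Sum>l<n. mvar l ^ i))"
proof -
  have quot: "(\<Prod>i\<in>{..<n} - {l}. [:- mvar i, 1:]) = synthetic_div (root_poly n) (mvar l)"
    if "l < n" for l
  proof -
    have "root_poly n = [:- mvar l, 1:] * (\<Prod>i\<in>{..<n} - {l}. [:- mvar i, 1:])"
      using that by (simp add: root_poly_def prod.remove[of "{..<n}" l])
    \<comment> \<open>The defining equation of synthetic division with remainder 0; its uniqueness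
      identifies the quotient.\<close>
    hence "root_poly n + smult (mvar l) (\<Prod>i\<in>{..<n} - {l}. [:- mvar i, 1:]) =
        pCons 0 (\<Prod>i\<in>{..<n} - {l}. [:- mvar i, 1:])"
      by (simp add: algebra_simps)
    from synthetic_div_unique[OF this] show ?thesis by simp
  qed
  have "of_nat (Suc j) * coeff (root_poly n) (Suc j) = coeff (pderiv (root_poly n)) j"
    by (simp add: coeff_pderiv)
  also have "pderiv (root_poly n) = (\<Sum>l<n. synthetic_div (root_poly n) (mvar l))"
    by (subst root_poly_def, subst pderiv_prod) (simp add: quot pderiv_pCons)
  also have "coeff \<dots> j = (\<Sum>l<n. \<Sum>i<n - j. coeff (root_poly n) (Suc (j + i)) * mvar l ^ i)"
    by (simp add: coeff_sum coeff_synthetic_div[of _ n] degree_root_poly)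
  also have "\<dots> = (\<Sum>i<n - j. coeff (root_poly n) (Suc (j + i)) * (\<Sum>l<n. mvar l ^ i))"
    by (subst sum.swap) (simp add: sum_distrib_left)
  finally show ?thesis .
qed

text \<open>For \<open>k < n\<close>, Newton's identity expresses the power sum by lower ones. For
  \<open>k \<ge> n\<close>, each root satisfies \<open>root_poly n\<close>, and multiplying that
  equation by the power \<open>k - n\<close> of the root gives a linear recurrence.\<close>

lemma power_sum_in_elementary_ring: "(\<Sum>l<n. mvar l ^ k) \<in> elementary_ring n"
proof (induction k rule: less_induct)
  case (less k)
  show ?case
  proof (cases "k < n")
    case True
    \<comment> \<open>With this \<open>j\<close> the last summand of Newton's identity is the
      \<open>k\<close>-th power sum times the leading coefficient 1, so it can be isolated without
      division.\<close>
    define j where "j = n - Suc k"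
    have "n - j = Suc k" "Suc (j + k) = n" using True by (auto simp: j_def)
    hence "(\<Sum>l<n. mvar l ^ k) = of_nat (Suc j) * coeff (root_poly n) (Suc j)
        - (\<Sum>i<k. coeff (root_poly n) (Suc (j + i)) * (\<Sum>l<n. mvar l ^ i))"
      unfolding newton_identity by (simp add: lead_coeff_root_poly)
    thus ?thesis
      by (auto intro!: elementary_ring_diff elementary_ring_sum elementary_ring_mult less.IH
            coeff_root_poly_in_elementary_ring simp: elementary_ring_of_nat simp del: of_nat_Suc)
  next
    case False
    have "mvar l ^ k = - (\<Sum>i<n. coeff (root_poly n) i * mvar l ^ (k - n + i))" if "l < n" for l
    proof -
      have "poly (root_poly n) (mvar l) = 0"
        using that by (auto simp: root_poly_def poly_prod)
      hence "(\<Sum>i\<le>n. coeff (root_poly n) i * mvar l ^ i) = 0"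
        by (simp add: poly_altdef degree_root_poly)
      hence "(\<Sum>i<n. coeff (root_poly n) i * mvar l ^ i) + mvar l ^ n = 0"
        by (simp add: lead_coeff_root_poly flip: lessThan_Suc_atMost)
      hence "mvar l ^ n = - (\<Sum>i<n. coeff (root_poly n) i * mvar l ^ i)"
        by (simp add: eq_neg_iff_add_eq_0 add.commute)
      moreover have "mvar l ^ k = mvar l ^ (k - n) * mvar l ^ n"
        using False by (simp flip: power_add)
      ultimately show ?thesis
        by (simp add: sum_distrib_left power_add mult_ac)
    qed
    hence "(\<Sum>l<n. mvar l ^ k) = (\<Sum>l<n. - (\<Sum>i<n. coeff (root_poly n) i * mvar l ^ (k - n + i)))"
      by (intro sum.cong) auto
    also have "\<dots> = - (\<Sum>i<n. coeff (root_poly n) i * (\<Sum>l<n. mvar l ^ (k - n + i)))"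
      by (subst sum_negf, subst sum.swap) (simp add: sum_distrib_left)
    also have "\<dots> \<in> elementary_ring n"
      using False by (intro elementary_ring_uminus elementary_ring_sum elementary_ring_mult
          coeff_root_poly_in_elementary_ring less.IH) auto
    finally show ?thesis .
  qed
qed

section \<open>Symmetric polynomials via sums over arrangements\<close>

text \<open>For \<open>k = n\<close> these are the permutations of the indices; the shorter ones
  serve the induction on the number of positions.\<close>

definition arrangements :: "nat \<Rightarrow> nat list set" where
  "arrangements k = {xs. length xs = k \<and> distinct xs \<and> set xs \<subseteq> {..<n}}"

lemma finite_arrangements: "finite (arrangements k)"
  by (rule finite_subset[OF _ finite_lists_length_eq[of "{..<n}" k]]) (auto simp: arrangements_def)

text \<open>Multiplying by a further power sum either uses a new index or raises the exponent of an
  old one; this expresses the sums over arrangements of length \<open>k + 1\<close> by those of length \<open>k\<close>.\<close>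

lemma monomial_sum_in_elementary_ring:
  "(\<Sum>xs\<in>arrangements k. \<Prod>j<k. mvar (xs ! j) ^ \<alpha> j) \<in> elementary_ring n"
proof (induction k arbitrary: \<alpha>)
  case 0
  have "arrangements 0 = {[]}" by (auto simp: arrangements_def)
  thus ?case by (simp add: elementary_ring_1)
next
  case (Suc k)
  define t where "t xs = (\<Prod>j<k. mvar (xs ! j) ^ \<alpha> j)" for xs
  \<comment> \<open>The exponents after the last index has coincided with the entry at position
    \<open>l\<close>.\<close>
  define \<beta> where "\<beta> l = \<alpha>(l := \<alpha> l + \<alpha> k)" for l
  have old: "t xs * (\<Sum>i\<in>set xs. mvar i ^ \<alpha> k) = (\<Sum>l<k. \<Prod>j<k. mvar (xs ! j) ^ \<beta> l j)"
    if "xs \<in> arrangements k" for xs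
  proof -
    have len: "length xs = k" "distinct xs" using that by (auto simp: arrangements_def)
    have "bij_betw (\<lambda>l. xs ! l) {..<k} (set xs)"
      using len by (intro bij_betw_nth) auto
    hence "(\<Sum>i\<in>set xs. mvar i ^ \<alpha> k) = (\<Sum>l<k. mvar (xs ! l) ^ \<alpha> k)"
      by (rule sum.reindex_bij_betw[symmetric])
    hence "t xs * (\<Sum>i\<in>set xs. mvar i ^ \<alpha> k) = (\<Sum>l<k. t xs * mvar (xs ! l) ^ \<alpha> k)"
      by (simp add: sum_distrib_left)
    also have "\<dots> = (\<Sum>l<k. \<Prod>j<k. mvar (xs ! j) ^ \<beta> l j)"
    proof (intro sum.cong refl)
      fix l assume "l \<in> {..<k}"
      thus "t xs * mvar (xs ! l) ^ \<alpha> k = (\<Prod>j<k. mvar (xs ! j) ^ \<beta> l j)"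
        by (simp add: t_def \<beta>_def prod.remove[of "{..<k}" l] power_add mult_ac)
    qed
    finally show ?thesis .
  qed
  \<comment> \<open>An arrangement of length \<open>k + 1\<close> is one of length \<open>k\<close>
    followed by an index not yet used.\<close>
  have "(\<Sum>xs\<in>arrangements (Suc k). \<Prod>j<Suc k. mvar (xs ! j) ^ \<alpha> j) =
      (\<Sum>(xs, i)\<in>(SIGMA xs:arrangements k. {..<n} - set xs). t xs * mvar i ^ \<alpha> k)"
  proof (rule sum.reindex_bij_witness[where i = "\<lambda>(xs, i). xs @ [i]" and j = "\<lambda>xs. (butlast xs, last xs)"])
    fix xs assume "xs \<in> arrangements (Suc k)"
    hence *: "length xs = Suc k" "distinct xs" "set xs \<subseteq> {..<n}" by (auto simp: arrangements_def)
    then obtain js i where js: "xs = js @ [i]" by (cases xs rule: rev_cases) auto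
    show "(case (butlast xs, last xs) of (xs, i) \<Rightarrow> xs @ [i]) = xs" by (simp add: js)
    show "(butlast xs, last xs) \<in> (SIGMA xs:arrangements k. {..<n} - set xs)"
      using * by (auto simp: js arrangements_def)
    show "(case (butlast xs, last xs) of (xs, i) \<Rightarrow> t xs * mvar i ^ \<alpha> k) = (\<Prod>j<Suc k. mvar (xs ! j) ^ \<alpha> j)"
      using * by (auto simp: js t_def nth_append)
  qed (auto simp: arrangements_def)
  also have "\<dots> = (\<Sum>xs\<in>arrangements k. \<Sum>i\<in>{..<n} - set xs. t xs * mvar i ^ \<alpha> k)"
    by (rule sum.Sigma[symmetric]) (auto simp: finite_arrangements)
  also have "\<dots> = (\<Sum>xs\<in>arrangements k. t xs * (\<Sum>i<n. mvar i ^ \<alpha> k) - t xs * (\<Sum>i\<in>set xs. mvar i ^ \<alpha> k))"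
    by (intro sum.cong refl, subst sum_diff)
       (auto simp: arrangements_def right_diff_distrib simp flip: sum_distrib_left)
  also have "\<dots> = (\<Sum>xs\<in>arrangements k. t xs) * (\<Sum>i<n. mvar i ^ \<alpha> k)
      - (\<Sum>l<k. \<Sum>xs\<in>arrangements k. \<Prod>j<k. mvar (xs ! j) ^ \<beta> l j)"
    by (simp add: sum_subtractf old sum_distrib_right sum.swap[of _ "{..<k}"])
  also have "\<dots> \<in> elementary_ring n"
    unfolding t_def
    by (rule elementary_ring_diff[OF elementary_ring_mult[OF Suc.IH power_sum_in_elementary_ring]
          elementary_ring_sum[OF Suc.IH]])
  finally show ?case .
qed

text \<open>A symmetric polynomial equals its own average over all arrangements of the variables, and
  the average of each monomial is one of the sums above.\<close>

theorem symmetric_in_elementary_ring: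
  assumes vars: "mvars p \<subseteq> {..<n}"
    and sym: "\<And>b. bij_betw b {..<n} {..<n} \<Longrightarrow> msubst (\<lambda>i. mvar (b i)) p = p"
  shows "p \<in> elementary_ring n"
proof -
  define N where "N = card (arrangements n)"
  have "[0..<n] \<in> arrangements n" by (auto simp: arrangements_def)
  hence "N \<noteq> 0" using finite_arrangements unfolding N_def by auto
  have perm: "msubst (\<lambda>i. mvar (xs ! i)) p = p" if "xs \<in> arrangements n" for xs
  proof (rule sym)
    have *: "length xs = n" "distinct xs" "set xs \<subseteq> {..<n}"
      using that by (auto simp: arrangements_def)
    moreover from this have "set xs = {..<n}"
      by (intro card_subset_eq) (auto simp: distinct_card)
    ultimately show "bij_betw (\<lambda>i. xs ! i) {..<n} {..<n}"
      by (intro bij_betw_nth) auto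
  qed
  \<comment> \<open>Padding with zeroth powers brings every monomial of \<open>p\<close> to a
    product over \<open>n\<close> positions, the shape of the arrangement sums.\<close>
  have mono: "(\<Prod>i\<in>Poly_Mapping.keys m. s i ^ Poly_Mapping.lookup m i) =
      (\<Prod>i<n. s i ^ Poly_Mapping.lookup m i)"
    if "m \<in> Poly_Mapping.keys p" for m and s :: "nat \<Rightarrow> mpoly"
  proof (rule prod.mono_neutral_left)
    show "Poly_Mapping.keys m \<subseteq> {..<n}" using that vars unfolding mvars_def by blast
  qed (auto simp: in_keys_iff)
  have "of_nat N * p = (\<Sum>xs\<in>arrangements n. msubst (\<lambda>i. mvar (xs ! i)) p)"
    by (simp add: perm N_def)
  also have "\<dots> = (\<Sum>m\<in>Poly_Mapping.keys p. mconst (Poly_Mapping.lookup p m) *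
      (\<Sum>xs\<in>arrangements n. \<Prod>i<n. mvar (xs ! i) ^ Poly_Mapping.lookup m i))"
    unfolding msubst_def by (subst sum.swap) (simp add: mono sum_distrib_left)
  also have "\<dots> \<in> elementary_ring n"
    by (rule elementary_ring_sum[OF elementary_ring_mult[OF elementary_ring_mconst monomial_sum_in_elementary_ring]])
  finally have "mconst (1 / of_nat N) * (of_nat N * p) \<in> elementary_ring n"
    by (rule elementary_ring_mult[OF elementary_ring_mconst])
  moreover have "mconst (1 / of_nat N) * of_nat N = 1"
    using \<open>N \<noteq> 0\<close> mconst.hom_mult[of "1 / of_nat N" "of_nat N"] by (simp add: mconst_def)
  ultimately show ?thesis by (metis mult.assoc mult_1_left)
qed

end

section \<open>Existence and uniqueness of \<open>D2\<close>\<close>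

lemma mvars_D2_roots: "mvars (D2_roots n) \<subseteq> {..<n}"
  unfolding D2_roots_def
proof (rule mvars_prod, clarify)
  fix i j k l :: nat assume "i < n" "j < n" "k < n" "l \<in> mvars (2 * mvar k - mvar i - mvar j)"
  moreover have "mvars (2 * mvar k - mvar i - mvar j) \<subseteq> {i, j, k}"
    using mvars_diff[of "2 * mvar k - mvar i" "mvar j"] mvars_diff[of "2 * mvar k" "mvar i"]
      mvars_mult[of 2 "mvar k"] by auto
  ultimately show "l < n" by auto
qed

text \<open>A permutation of the roots permutes the factors. It may destroy the ordering
  \<open>i < j\<close>, but a factor is symmetric in \<open>i\<close> and \<open>j\<close>, so
  \<open>act\<close> re-sorts the first two indices.\<close>

lemma D2_roots_symmetric:
  assumes "bij_betw b {..<n} {..<n}"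
  shows "msubst (\<lambda>i. mvar (b i)) (D2_roots n) = D2_roots n"
proof -
  define A where "A = {(i, j, k). i < n \<and> j < n \<and> k < n \<and> i < j \<and> j \<noteq> k \<and> k \<noteq> i}"
  define act :: "(nat \<Rightarrow> nat) \<Rightarrow> nat \<times> nat \<times> nat \<Rightarrow> nat \<times> nat \<times> nat"
    where "act b = (\<lambda>(i, j, k). (min (b i) (b j), max (b i) (b j), b k))" for b
  define b' where "b' = inv_into {..<n} b"
  have b': "bij_betw b' {..<n} {..<n}"
    unfolding b'_def by (rule bij_betw_inv_into[OF assms])
  have inv: "b' (b i) = i" "b (b' i) = i" if "i < n" for i
    using that assms by (auto simp: b'_def bij_betw_inv_into_left bij_betw_inv_into_right)
  have act_in: "act c t \<in> A" if "bij_betw c {..<n} {..<n}" "t \<in> A" for c t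
  proof -
    have "c i < n" if "i < n" for i
      using that \<open>bij_betw c _ _\<close> by (auto dest: bij_betwE)
    moreover have "c i = c j \<longleftrightarrow> i = j" if "i < n" "j < n" for i j
      using that \<open>bij_betw c _ _\<close> by (auto simp: bij_betw_def inj_on_def)
    moreover obtain i j k where "t = (i, j, k)" by (cases t)
    ultimately show ?thesis
      using that(2) by (simp add: A_def act_def min_def max_def less_le)
  qed
  have "msubst (\<lambda>i. mvar (b i)) (D2_roots n) =
      (\<Prod>(i, j, k)\<in>A. 2 * mvar (b k) - mvar (b i) - mvar (b j))"
    unfolding D2_roots_def A_def[symmetric] msubst_eq_meval mconst.meval_prod
    by (intro prod.cong refl) (auto simp: mconst.meval_diff mconst.meval_mult)
  also have "\<dots> = (\<Prod>(i, j, k)\<in>A. 2 * mvar k - mvar i - mvar j)"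
  proof (rule prod.reindex_bij_witness[where i = "act b'" and j = "act b"])
    fix t assume t: "t \<in> A"
    show "act b t \<in> A" "act b' t \<in> A" using act_in assms b' t by auto
    show "act b' (act b t) = t" "act b (act b' t) = t"
      using t inv by (auto simp: A_def act_def min_def max_def)
    show "(case act b t of (i, j, k) \<Rightarrow> 2 * mvar k - mvar i - mvar j) =
        (case t of (i, j, k) \<Rightarrow> 2 * mvar (b k) - mvar (b i) - mvar (b j))"
      by (auto simp: act_def min_def max_def split: prod.splits)
  qed
  finally show ?thesis by (simp add: D2_roots_def A_def)
qed

lemma monic_complex_splits:
  fixes P :: "complex poly"
  assumes "degree P = n" "lead_coeff P = 1"
  obtains r where "P = (\<Prod>j<n. [:- r j, 1:])"
proof -
  have "P \<noteq> 0" using assms by auto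
  from alg_closed_imp_factorization[OF this] assms
  obtain A where A: "size A = n" "P = (\<Prod>x\<in>#A. [:- x, 1:])" by auto
  obtain xs where xs: "mset xs = A" using ex_mset by blast
  have "length xs = n" using A(1) xs by auto
  moreover have "P = prod_list (map (\<lambda>x. [:- x, 1:]) xs)"
    using A(2) unfolding xs[symmetric] by (metis mset_map prod_mset_prod_list)
  ultimately have "P = (\<Prod>j<n. [:- xs ! j, 1:])"
    by (simp add: prod.list_conv_set_nth atLeast0LessThan)
  thus ?thesis by (rule that)
qed

lemma meval_vieta:
  assumes "i < n"
  shows "meval of_rat r (vieta n i) = coeff (\<Prod>j<n. [:- r j, 1::complex:]) i"
proof -
  have "map_poly (meval of_rat r) (\<Prod>j<n. [:- mvar j, 1:]) = (\<Prod>j<n. [:- r j, 1::complex:])"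
    by (simp add: of_rat.map_poly_meval_prod of_rat.map_poly_meval_linear)
  thus ?thesis
    using assms by (simp add: vieta_def flip: of_rat.coeff_map_poly_meval)
qed

text \<open>Links values at roots with values at coefficients. The bound on the variables matters,
  since \<open>vieta n n\<close> is 0 while the coefficient at \<open>n\<close> is 1.\<close>

lemma meval_msubst_vieta:
  assumes "mvars D \<subseteq> {..<n}"
  shows "meval of_rat r (msubst (vieta n) D) = meval of_rat (coeff (\<Prod>j<n. [:- r j, 1::complex:])) D"
  unfolding of_rat.meval_msubst using assms by (intro meval_cong) (auto simp: meval_vieta)

text \<open>Algebraic independence of the elementary symmetric polynomials: every complex point
  \<open>c\<close> is the coefficient vector of a monic polynomial, which has roots, so
  \<open>D\<close> and \<open>D'\<close> agree at \<open>c\<close>.\<close>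

lemma msubst_vieta_inject:
  assumes "mvars D \<subseteq> {..<n}" "mvars D' \<subseteq> {..<n}" "msubst (vieta n) D = msubst (vieta n) D'"
  shows "D = D'"
proof -
  have "D - D' = 0"
  proof (rule mpoly_eq_0_if_vanishing)
    fix c :: "nat \<Rightarrow> complex"
    define P where "P = monom 1 n + (\<Sum>i<n. monom (c i) i)"
    have P: "coeff P i = (if i = n then 1 else if i < n then c i else 0)" for i
      by (simp add: P_def coeff_sum)
    hence deg: "degree P = n"
      by (intro antisym degree_le le_degree) auto
    obtain r where r: "P = (\<Prod>j<n. [:- r j, 1:])"
      by (rule monic_complex_splits[OF deg]) (auto simp: deg P)
    have "meval of_rat c E = meval of_rat r (msubst (vieta n) E)" if "mvars E \<subseteq> {..<n}" for E
      unfolding meval_msubst_vieta[OF that] using that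
      by (intro meval_cong) (auto simp: P simp flip: r)
    thus "meval of_rat c (D - D') = 0"
      using assms by (simp add: of_rat.meval_diff)
  qed
  thus ?thesis by simp
qed

text \<open>Symmetry of \<open>D2_roots n\<close> gives existence and injectivity of the
  substitution gives uniqueness, so the description operator in \<open>D2\<close> denotes.\<close>

lemma D2_spec: "mvars (D2 n) \<subseteq> {..<n} \<and> msubst (vieta n) (D2 n) = D2_roots n"
proof -
  have "D2_roots n \<in> elementary_ring n"
    by (intro symmetric_in_elementary_ring mvars_D2_roots D2_roots_symmetric)
  then obtain D where D: "mvars D \<subseteq> {..<n} \<and> msubst (vieta n) D = D2_roots n"
    unfolding elementary_ring_def by auto
  show ?thesis
    unfolding D2_def using D by (rule theI) (use msubst_vieta_inject D in metis)
qed

section \<open>Vanishing of \<open>D2\<close> when one root is the midpoint of two others\<close>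

lemma D2_midpoint_vanishing:
  fixes r :: "nat \<Rightarrow> complex"
  assumes "n \<ge> 3" "2 * r 2 = r 0 + r 1"
  shows "meval of_rat (coeff (\<Prod>j<n. [:- r j, 1:])) (D2 n) = 0"
proof -
  let ?A = "{(i, j, k). i < n \<and> j < n \<and> k < n \<and> i < j \<and> j \<noteq> k \<and> k \<noteq> i}"
  have "finite ?A"
    by (rule finite_subset[of _ "{..<n} \<times> {..<n} \<times> {..<n}"]) auto
  moreover have "(0, 1, 2) \<in> ?A" using assms by auto
  ultimately have "meval of_rat r (D2_roots n) = 0"
    unfolding D2_roots_def of_rat.meval_prod using assms(2)
    by (intro prod_zero bexI[of _ "(0, 1, 2)"]) (auto simp: of_rat.meval_diff of_rat.meval_mult)
  thus ?thesis
    using D2_spec[of n] meval_msubst_vieta[of "D2 n" n r] by simp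
qed

text \<open>This is an identity of polynomials, not merely a congruence. At each complex point
  \<open>h\<close> splits, and the three explicit roots produce a vanishing factor of
  \<open>D2_roots\<close>.\<close>

lemma msubst_D2_midpoint:
  assumes "degree h = n - 3" "lead_coeff h = 1" "n \<ge> 3"
  shows "msubst (coeff ([:- x, 1:] * ([:- y, 1:] * ([:- (mconst (1/2) * (x + y)), 1:] * h)))) (D2 n) = 0"
proof (rule mpoly_eq_0_if_vanishing)
  fix c :: "nat \<Rightarrow> complex"
  define ev where "ev = meval of_rat c"
  define h' where "h' = map_poly ev h"
  have coeff_h': "coeff h' i = ev (coeff h i)" for i
    by (simp add: h'_def ev_def of_rat.coeff_map_poly_meval)
  have lead: "coeff h' (n - 3) = 1"
    using assms by (simp add: coeff_h' ev_def)
  \<comment> \<open>The leading coefficient 1 survives evaluation, so the degree does not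
    drop.\<close>
  have deg: "degree h' = n - 3"
    using lead assms(1) by (intro antisym degree_le le_degree) (auto simp: coeff_h' coeff_eq_0 ev_def)
  obtain s where s: "h' = (\<Prod>j<n - 3. [:- s j, 1:])"
    by (rule monic_complex_splits[OF deg]) (simp add: deg lead)
  \<comment> \<open>The midpoint is placed at index 2, after its two endpoints, and the roots of
    \<open>h\<close> are shifted by 3.\<close>
  define r where "r j = (if j = 0 then ev x else if j = 1 then ev y
    else if j = 2 then (ev x + ev y) / 2 else s (j - 3))" for j
  have "n = Suc (Suc (Suc (n - 3)))" using assms by simp
  hence "(\<Prod>j<n. [:- r j, 1:]) = (\<Prod>j<Suc (Suc (Suc (n - 3))). [:- r j, 1:])"
    by (rule arg_cong)
  also have "\<dots> = [:- ev x, 1:] * ([:- ev y, 1:] * ([:- ((ev x + ev y) / 2), 1:] * h'))"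
    unfolding prod.lessThan_Suc_shift by (simp add: r_def s numeral_2_eq_2 numeral_3_eq_3)
  also have "\<dots> = map_poly ev ([:- x, 1:] * ([:- y, 1:] * ([:- (mconst (1/2) * (x + y)), 1:] * h)))"
    by (simp only: ev_def of_rat.map_poly_meval_mult of_rat.map_poly_meval_linear h'_def
        of_rat.meval_mult of_rat.meval_add of_rat.meval_mconst) (simp add: of_rat_divide)
  finally have r: "map_poly ev ([:- x, 1:] * ([:- y, 1:] * ([:- (mconst (1/2) * (x + y)), 1:] * h))) =
      (\<Prod>j<n. [:- r j, 1:])" by simp
  have "meval of_rat c (msubst (coeff ([:- x, 1:] * ([:- y, 1:] * ([:- (mconst (1/2) * (x + y)), 1:] * h)))) (D2 n))
      = meval of_rat (coeff (\<Prod>j<n. [:- r j, 1:])) (D2 n)"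
    unfolding of_rat.meval_msubst r[symmetric] ev_def of_rat.coeff_map_poly_meval ..
  also have "\<dots> = 0"
    by (rule D2_midpoint_vanishing[OF assms(3)]) (simp add: r_def)
  finally show "meval of_rat c (msubst (coeff ([:- x, 1:] * ([:- y, 1:] *
      ([:- (mconst (1/2) * (x + y)), 1:] * h)))) (D2 n)) = 0" .
qed

section \<open>Ideals and congruences\<close>

lemma ideal_gen_0: "0 \<in> ideal_gen gs"
  unfolding ideal_gen_def by (auto intro!: exI[of _ "\<lambda>_. 0"])

lemma ideal_gen_add: "p \<in> ideal_gen gs \<Longrightarrow> q \<in> ideal_gen gs \<Longrightarrow> p + q \<in> ideal_gen gs"
  unfolding ideal_gen_def
proof clarify
  fix h k
  show "\<exists>l. (\<Sum>i<length gs. h i * gs ! i) + (\<Sum>i<length gs. k i * gs ! i) =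
      (\<Sum>i<length gs. l i * gs ! i) \<and> True"
    by (intro exI[of _ "\<lambda>i. h i + k i"]) (simp add: sum.distrib algebra_simps)
qed

lemma ideal_gen_mult: "p \<in> ideal_gen gs \<Longrightarrow> q * p \<in> ideal_gen gs"
  unfolding ideal_gen_def
proof clarify
  fix h
  show "\<exists>l. q * (\<Sum>i<length gs. h i * gs ! i) = (\<Sum>i<length gs. l i * gs ! i) \<and> True"
    by (intro exI[of _ "\<lambda>i. q * h i"]) (simp add: sum_distrib_left mult_ac)
qed

lemma ideal_gen_uminus: "p \<in> ideal_gen gs \<Longrightarrow> - p \<in> ideal_gen gs"
  using ideal_gen_mult[of p gs "- 1"] by simp

lemma ideal_gen_diff: "p \<in> ideal_gen gs \<Longrightarrow> q \<in> ideal_gen gs \<Longrightarrow> p - q \<in> ideal_gen gs"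
  using ideal_gen_add[of p gs "- q"] ideal_gen_uminus[of q gs] by simp

lemma ideal_gen_sum: "(\<And>i. i \<in> A \<Longrightarrow> g i \<in> ideal_gen gs) \<Longrightarrow> (\<Sum>i\<in>A. g i) \<in> ideal_gen gs"
  by (induction A rule: infinite_finite_induct) (auto intro: ideal_gen_0 ideal_gen_add)

lemma ideal_gen_generator: "g \<in> set gs \<Longrightarrow> g \<in> ideal_gen gs"
proof -
  assume "g \<in> set gs"
  then obtain j where "j < length gs" "g = gs ! j" by (auto simp: in_set_conv_nth)
  thus ?thesis
    unfolding ideal_gen_def
    by (auto intro!: exI[of _ "\<lambda>i. if i = j then 1 else 0"] simp: if_distrib[of "\<lambda>c. c * _"] cong: if_cong)
qed

lemma ideal_gen_mult_cong:
  assumes "a - b \<in> ideal_gen gs" "c - d \<in> ideal_gen gs"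
  shows "a * c - b * d \<in> ideal_gen gs"
proof -
  have "a * c - b * d = a * (c - d) + d * (a - b)" by (simp add: algebra_simps)
  thus ?thesis using assms by (auto intro: ideal_gen_add ideal_gen_mult)
qed

lemma ideal_gen_power_cong: "a - b \<in> ideal_gen gs \<Longrightarrow> a ^ k - b ^ k \<in> ideal_gen gs"
  by (induction k) (auto intro: ideal_gen_mult_cong ideal_gen_0)

lemma ideal_gen_prod_cong:
  "(\<And>i. i \<in> A \<Longrightarrow> a i - b i \<in> ideal_gen gs) \<Longrightarrow> (\<Prod>i\<in>A. a i) - (\<Prod>i\<in>A. b i) \<in> ideal_gen gs"
  by (induction A rule: infinite_finite_induct) (auto intro: ideal_gen_mult_cong ideal_gen_0)

text \<open>Allows the coefficients of the generic polynomial to be exchanged for congruent ones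
  inside \<open>D2\<close>.\<close>

lemma msubst_cong_mod_ideal:
  assumes "\<And>i. i \<in> mvars p \<Longrightarrow> \<sigma> i - \<tau> i \<in> ideal_gen gs"
  shows "msubst \<sigma> p - msubst \<tau> p \<in> ideal_gen gs"
  unfolding msubst_def sum_subtractf[symmetric] right_diff_distrib[symmetric]
  by (intro ideal_gen_sum ideal_gen_mult ideal_gen_prod_cong ideal_gen_power_cong assms)
     (auto simp: mvars_def)

section \<open>Division by linear factors and the ideal membership\<close>

lemma synthetic_div_monic:
  fixes P :: "'a::comm_ring_1 poly"
  assumes "degree P = Suc d" "lead_coeff P = 1"
  shows "degree (synthetic_div P c) = d" and "lead_coeff (synthetic_div P c) = 1"
proof -
  show "degree (synthetic_div P c) = d"
    using assms by (simp add: degree_synthetic_div)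
  moreover have "coeff (synthetic_div P c) d = 1"
    using assms by (simp add: coeff_synthetic_div[of P "Suc d"])
  ultimately show "lead_coeff (synthetic_div P c) = 1" by simp
qed

text \<open>Shows that a root \<open>z\<close> of \<open>P\<close> passes to the quotient by
  \<open>c\<close> once \<open>z - c\<close> can be cancelled.\<close>

lemma poly_synthetic_div:
  fixes P :: "'a::comm_ring_1 poly"
  shows "(z - c) * poly (synthetic_div P c) z = poly P z - poly P c"
  using arg_cong[OF synthetic_div_correct'[of c P], of "\<lambda>q. poly q z"] by (simp add: algebra_simps)

theorem corollary2:
  fixes n :: nat
  assumes "n \<ge> 3"
  shows "D2 n \<in> ideal_gen
           [f_at n (mvar n), f_at n (mvar (n+1)),
            f_at n (mconst (1/2) * (mvar n + mvar (n+1))),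
            mvar (n+2) * (mvar n - mvar (n+1)) - 1]
         \<inter> {p. mvars p \<subseteq> {..<n}}"
proof -
  define x y w where xyw: "x = mvar n" "y = mvar (n+1)" "w = mvar (n+2)"
  define z where "z = mconst (1/2) * (x + y)"
  define I where "I = ideal_gen [f_at n x, f_at n y, f_at n z, w * (x - y) - 1]"
  define F where "F = monom 1 n + (\<Sum>i<n. monom (mvar i) i)"
  have coeff_F: "coeff F i = (if i = n then 1 else if i < n then mvar i else 0)" for i
    by (simp add: F_def coeff_sum)
  hence deg_F: "degree F = n"
    by (intro antisym degree_le le_degree) auto
  have poly_F: "poly F t = f_at n t" for t
    by (simp add: F_def f_at_def poly_monom poly_sum)
  have gens: "f_at n x \<in> I" "f_at n y \<in> I" "f_at n z \<in> I" "w * (x - y) - 1 \<in> I"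
    unfolding I_def by (auto intro: ideal_gen_generator)
  note closed = ideal_gen_add[where gs = "[f_at n x, f_at n y, f_at n z, w * (x - y) - 1]", folded I_def]
    ideal_gen_diff[where gs = "[f_at n x, f_at n y, f_at n z, w * (x - y) - 1]", folded I_def]
    ideal_gen_mult[where gs = "[f_at n x, f_at n y, f_at n z, w * (x - y) - 1]", folded I_def]
  \<comment> \<open>Modulo \<open>I\<close>, \<open>w\<close> is an inverse of
    \<open>x - y\<close>.\<close>
  have cancel: "p \<in> I" if "(x - y) * p \<in> I" for p
  proof -
    have "p = w * ((x - y) * p) - p * (w * (x - y) - 1)" by (simp add: algebra_simps)
    thus ?thesis using that gens closed by metis
  qed

  \<comment> \<open>Successive quotients by the linear factors at \<open>x\<close>,
    \<open>y\<close>, \<open>z\<close>. The remainders are \<open>f(x)\<close>, \<open>q(y)\<close>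
    and \<open>g(z)\<close>; the last two still have to be shown to lie in \<open>I\<close>.\<close>
  define q where "q = synthetic_div F x"
  define g where "g = synthetic_div q y"
  define h where "h = synthetic_div g z"
  have n: "n = Suc (Suc (Suc (n - 3)))" using assms by simp
  have F: "degree F = Suc (Suc (Suc (n - 3)))" "lead_coeff F = 1"
    using n by (simp_all add: deg_F coeff_F)
  have q: "degree q = Suc (Suc (n - 3))" "lead_coeff q = 1"
    unfolding q_def using synthetic_div_monic[OF F] by simp_all
  have g: "degree g = Suc (n - 3)" "lead_coeff g = 1"
    unfolding g_def using synthetic_div_monic[OF q] by simp_all
  have h: "degree h = n - 3" "lead_coeff h = 1"
    unfolding h_def using synthetic_div_monic[OF g] by simp_all

  have "(x - y) * poly q y = f_at n x - f_at n y"
    using poly_synthetic_div[of y x F] by (simp add: q_def poly_F algebra_simps)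
  hence q_y: "poly q y \<in> I" using cancel gens closed by metis
  have "mconst (1/2) * 2 = 1" using mconst.hom_mult[of "1/2" 2] by (simp add: mconst_def)
  hence half: "2 * (mconst (1/2) * t) = t" for t by (simp flip: mult.assoc add: mult.commute)
  have "2 * (z - x) = y - x" "2 * (z - y) = x - y"
    unfolding z_def right_diff_distrib half by simp_all
  \<comment> \<open>From the doubled differences,
    \<open>4 * (z - x) * (z - y) = - (x - y)^2\<close>; thus cancelling \<open>x - y\<close> twice
    removes both factors at \<open>z\<close>.\<close>
  hence "(x - y) * ((x - y) * poly g z) = - (4 * ((z - x) * ((z - y) * poly g z)))"
    by algebra
  also have "(z - y) * poly g z = poly q z - poly q y"
    unfolding g_def by (rule poly_synthetic_div)
  also have "(z - x) * \<dots> = f_at n z - f_at n x - (z - x) * poly q y"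
    using poly_synthetic_div[of z x F] by (simp add: q_def poly_F algebra_simps)
  finally have "(x - y) * ((x - y) * poly g z) =
      (-4) * (f_at n z - f_at n x - (z - x) * poly q y)" by simp
  hence g_z: "poly g z \<in> I" using cancel gens closed q_y by metis

  \<comment> \<open>\<open>F\<close> with all three remainders dropped; \<open>F - G\<close>
    therefore has its coefficients in \<open>I\<close>.\<close>
  define G where "G = [:- x, 1:] * ([:- y, 1:] * ([:- z, 1:] * h))"
  have "F = [:- x, 1:] * ([:- y, 1:] * ([:- z, 1:] * h + [:poly g z:]) + [:poly q y:]) + [:f_at n x:]"
    by (simp only: h_def g_def q_def synthetic_div_correct' flip: poly_F)
  also have "\<dots> - G = smult (poly g z) ([:- x, 1:] * [:- y, 1:]) + smult (poly q y) [:- x, 1:] + [:f_at n x:]"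
    by (simp add: G_def algebra_simps)
  finally have diff: "F - G = \<dots>" .
  have "coeff F i - coeff G i \<in> I" for i
  proof -
    have "coeff F i - coeff G i = coeff (F - G) i" by simp
    also have "\<dots> = coeff ([:- x, 1:] * [:- y, 1:]) i * poly g z + coeff [:- x, 1:] i * poly q y
        + coeff 1 i * f_at n x"
      unfolding diff by (simp add: coeff_pCons split: nat.split)
    finally show ?thesis using closed gens q_y g_z by metis
  qed
  \<comment> \<open>The indeterminates below \<open>n\<close> are the lower coefficients of
    \<open>F\<close>, so \<open>D2 n\<close> is congruent to its value at the coefficients of
    \<open>G\<close>.\<close>
  hence "msubst mvar (D2 n) - msubst (coeff G) (D2 n) \<in> I"
    unfolding I_def using D2_spec[of n]
    by (intro msubst_cong_mod_ideal) (auto simp: coeff_F dest!: meta_spec split: if_splits)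
  moreover have "msubst (coeff G) (D2 n) = 0"
    unfolding G_def z_def by (rule msubst_D2_midpoint[OF h assms])
  ultimately have "D2 n \<in> I" by (simp add: msubst_mvar)
  thus ?thesis
    using D2_spec[of n] by (simp add: I_def z_def xyw)
qed

end
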